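(* Let $(G,\boldsymbol{T},l,u,w)$ be a harmonic MPESP instance whose digraph $G=(V,A)$ is connected. Then any maximum weight spanning tree algorithm with respect to the arc weights $T_a$, $a\in A$, finds a sharp spanning tree; that is, every spanning tree $H$ of $G$ maximizing $\sum_{a\in H}T_a$ is sharp.
   Context: $\mathbb{N}$ denotes the positive integers. An MPESP (Multiperiodic Event Scheduling Problem) instance $(G,\boldsymbol{T},l,u,w)$ consists of a finite digraph $G=(V,A)$, a vector $\boldsymbol{T}=(T_i)_{i\in V}\in\mathbb{N}^V$ of event periods, bounds $l,u\in\mathbb{R}^A$ and weights $w\in\mathbb{R}^A$. For an arc $a=(i,j)\in A$ set $T_a:=\gcd\{T_i,T_j\}$. Connectedness, spanning trees and cycles are understood in the underlying undirected graph. For a cycle $C$ set $T_C:=\gcd\{T_a\mid a\in C\}$. Let $\mathcal{T}:=\{T_i\mid i\in V\}$. The instance is harmonic if $\mathcal{T}$ is totally ordered under divisibility, i.e., for all $T,T'\in\mathcal{T}$, either $T$ divides $T'$ or $T'$ divides $T$. A spanning tree $H$ of $G$ is sharp if for every co-tree arc $a\notin H$, the cycle $C$ created by adding $a$ to $H$ satisfies $T_C=T_a$. *)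

theory Defs
  imports Complex_Main "Graph_Theory.Digraph_Component"
begin

text \<open>Parallel arcs, antiparallel arcs and loops are allowed. The arguments \<open>l\<close>, \<open>u\<close>, \<open>w\<close>
  are unconstrained real vectors indexed by the arcs; only their values on \<open>arcs G\<close> matter.\<close>

definition mpesp_instance ::
  "('v, 'a) pre_digraph \<Rightarrow> ('v \<Rightarrow> nat) \<Rightarrow> ('a \<Rightarrow> real) \<Rightarrow> ('a \<Rightarrow> real) \<Rightarrow> ('a \<Rightarrow> real) \<Rightarrow> bool"
where
  "mpesp_instance G T l u w \<longleftrightarrow> fin_digraph G \<and> (\<forall>i\<in>verts G. 0 < T i)"

definition harmonic :: "('v, 'a) pre_digraph \<Rightarrow> ('v \<Rightarrow> nat) \<Rightarrow> bool" where
  "harmonic G T \<longleftrightarrow> (\<forall>t\<in>T ` verts G. \<forall>t'\<in>T ` verts G. t dvd t' \<or> t' dvd t)"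

definition arc_period :: "('v, 'a) pre_digraph \<Rightarrow> ('v \<Rightarrow> nat) \<Rightarrow> 'a \<Rightarrow> nat" where
  "arc_period G T a = gcd (T (tail G a)) (T (head G a))"

definition cycle_period :: "('v, 'a) pre_digraph \<Rightarrow> ('v \<Rightarrow> nat) \<Rightarrow> 'a set \<Rightarrow> nat" where
  "cycle_period G T C = Gcd (arc_period G T ` C)"

text \<open>The constants \<^const>\<open>forest\<close>, \<^const>\<open>tree\<close> and \<^const>\<open>spanning_tree\<close> of the graph library
  only exclude directed cycles, so they are not the notions of the underlying undirected graph.
  (\<^const>\<open>Digraph_Component.connected\<close>, in contrast, is connectedness of the underlying undirected graph.)
  The arc \<open>(a, True)\<close> below is \<open>a\<close> traversed forwards, \<open>(a, False)\<close> is \<open>a\<close> traversed backwards.\<close>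

definition bidirect :: "('v, 'a) pre_digraph \<Rightarrow> ('v, 'a \<times> bool) pre_digraph" where
  "bidirect G = \<lparr> verts = verts G, arcs = arcs G \<times> UNIV,
     tail = (\<lambda>(a, fwd). if fwd then tail G a else head G a),
     head = (\<lambda>(a, fwd). if fwd then head G a else tail G a) \<rparr>"

text \<open>\<open>C\<close> is the arc set of a cycle of the underlying undirected multigraph. Distinctness of
  the arcs rules out going back and forth along one arc, but keeps loops and the cycles of
  length two formed by parallel or antiparallel arcs.\<close>

definition undirected_cycle :: "('v, 'a) pre_digraph \<Rightarrow> 'a set \<Rightarrow> bool" where
  "undirected_cycle G C \<longleftrightarrow>
     (\<exists>p. pre_digraph.cycle (bidirect G) p \<and> distinct (map fst p) \<and> C = fst ` set p)"

definition undirected_tree :: "('v, 'a) pre_digraph \<Rightarrow> bool" where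
  "undirected_tree H \<longleftrightarrow> Digraph_Component.connected H \<and> (\<nexists>C. undirected_cycle H C)"

definition undirected_spanning_tree ::
  "('v, 'a) pre_digraph \<Rightarrow> ('v, 'a) pre_digraph \<Rightarrow> bool"
where
  "undirected_spanning_tree H G \<longleftrightarrow> undirected_tree H \<and> spanning H G"

text \<open>Adding an arc of \<open>arcs G - arcs H\<close> to a spanning tree \<open>H\<close> of \<open>G\<close> creates exactly one
  cycle, so the description is only meant for this case.\<close>

definition fundamental_cycle :: "('v, 'a) pre_digraph \<Rightarrow> 'a \<Rightarrow> 'a set" where
  "fundamental_cycle H a = (THE C. undirected_cycle (pre_digraph.add_arc H a) C)"

definition sharp :: "('v, 'a) pre_digraph \<Rightarrow> ('v \<Rightarrow> nat) \<Rightarrow> ('v, 'a) pre_digraph \<Rightarrow> bool" where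
  "sharp G T H \<longleftrightarrow>
     (\<forall>a\<in>arcs G - arcs H. cycle_period G T (fundamental_cycle H a) = arc_period G T a)"

definition max_weight_spanning_tree ::
  "('v, 'a) pre_digraph \<Rightarrow> ('a \<Rightarrow> nat) \<Rightarrow> ('v, 'a) pre_digraph \<Rightarrow> bool"
where
  "max_weight_spanning_tree G c H \<longleftrightarrow> undirected_spanning_tree H G \<and>
     (\<forall>H'. undirected_spanning_tree H' G \<longrightarrow> sum c (arcs H') \<le> sum c (arcs H))"

end

theory Submission
  imports Defs
begin

text \<open>If \<open>b\<close> lies on the fundamental cycle of a co-tree arc \<open>a\<close>, then exchanging \<open>b\<close> for \<open>a\<close>
  in \<open>H\<close> gives another spanning tree, so maximality of \<open>H\<close> forces \<open>T\<^sub>a \<le> T\<^sub>b\<close>. In a harmonic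
  instance the arc periods are themselves event periods, hence totally ordered by divisibility,
  and \<open>T\<^sub>a \<le> T\<^sub>b\<close> improves to \<open>T\<^sub>a dvd T\<^sub>b\<close>. Therefore \<open>T\<^sub>a\<close> is the gcd over the cycle.\<close>

section \<open>Undirected reachability within a set of arcs\<close>

text \<open>A symmetric relation whose reflexive transitive closure is reachability in the
  underlying undirected graph. Taking an arbitrary arc set \<open>F\<close> allows arcs to be
  dropped without forming a new digraph.\<close>

definition links :: "('v, 'a) pre_digraph \<Rightarrow> 'a set \<Rightarrow> 'v rel" where
  "links G F = (\<Union>e\<in>F. {(tail G e, head G e), (head G e, tail G e)})"

lemma linksI: "e \<in> F \<Longrightarrow> (tail G e, head G e) \<in> links G F"
  by (auto simp: links_def)

lemma links_mono: "F \<subseteq> F' \<Longrightarrow> links G F \<subseteq> links G F'"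
  by (auto simp: links_def)

lemma links_rtrancl_mono: "(u, v) \<in> (links G F)\<^sup>* \<Longrightarrow> F \<subseteq> F' \<Longrightarrow> (u, v) \<in> (links G F')\<^sup>*"
  by (rule subsetD[OF rtrancl_mono[OF links_mono]])

lemma links_rtrancl_sym: "(u, v) \<in> (links G F)\<^sup>* \<Longrightarrow> (v, u) \<in> (links G F)\<^sup>*"
  by (rule symD[OF sym_rtrancl]) (auto simp: sym_def links_def)

lemma links_cong: "tail G = tail H \<Longrightarrow> head G = head H \<Longrightarrow> links G = links H"
  by (simp add: links_def fun_eq_iff)

text \<open>Every step along an arc of \<open>F\<close>, in either direction, can be rerouted
  through \<open>F'\<close>. This is how an arc is bypassed along the rest of a cycle.\<close>

lemma links_rtrancl_replace:
  assumes "(u, v) \<in> (links G F)\<^sup>*"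
    and "\<And>e. e \<in> F \<Longrightarrow> (tail G e, head G e) \<in> (links G F')\<^sup>*"
  shows "(u, v) \<in> (links G F')\<^sup>*"
proof -
  have "links G F \<subseteq> (links G F')\<^sup>*"
    using assms(2) links_rtrancl_sym[OF assms(2)] unfolding links_def[of G F] by auto
  then show ?thesis
    by (rule subsetD[OF rtrancl_subset_rtrancl]) (fact assms(1))
qed

text \<open>Connectedness in the graph library is strong connectedness of the symmetric closure, and
  the arcs of that closure are exactly the links.\<close>

lemma connected_iff_links:
  assumes "wf_digraph G"
  shows "Digraph_Component.connected G \<longleftrightarrow>
    verts G \<noteq> {} \<and> (\<forall>u\<in>verts G. \<forall>v\<in>verts G. (u, v) \<in> (links G (arcs G))\<^sup>*)"
proof -
  interpret wf_digraph G by fact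
  interpret S: pair_wf_digraph "mk_symmetric G" ..
  have "arcs_ends (with_proj (mk_symmetric G)) = links G (arcs G)"
    by (simp add: parcs_mk_symmetric links_def)
  then show ?thesis
    unfolding connected_def strongly_connected_def
    by (auto simp: S.reachable_conv')
qed

section \<open>Walks in the bidirected digraph\<close>

lemma bidirect_simps [simp]:
  "verts (bidirect G) = verts G"
  "arcs (bidirect G) = arcs G \<times> UNIV"
  "tail (bidirect G) (e, True) = tail G e"
  "tail (bidirect G) (e, False) = head G e"
  "head (bidirect G) (e, True) = head G e"
  "head (bidirect G) (e, False) = tail G e"
  by (simp_all add: bidirect_def)

lemma bidirect_ends:
  "{tail (bidirect G) x, head (bidirect G) x} = {tail G (fst x), head G (fst x)}"
proof -
  obtain e d where "x = (e, d)" by fastforce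
  then show ?thesis by (cases d) (simp_all add: insert_commute)
qed

lemma wf_digraph_bidirect:
  assumes "wf_digraph G"
  shows "wf_digraph (bidirect G)"
proof -
  interpret wf_digraph G by fact
  show ?thesis by unfold_locales (auto simp: bidirect_def)
qed

lemma compatible_bidirect:
  "tail G = tail H \<Longrightarrow> head G = head H \<Longrightarrow> compatible (bidirect G) (bidirect H)"
  by (auto simp: compatible_def bidirect_def fun_eq_iff)

lemma arcs_ends_bidirect: "arcs_ends (bidirect G) = links G (arcs G)"
proof -
  \<comment> \<open>Separating the two orientations makes the Boolean literal, so that the rules for
    \<open>tail\<close> and \<open>head\<close> of \<open>bidirect\<close> apply.\<close>
  have split: "arcs G \<times> (UNIV :: bool set) = (\<lambda>e. (e, True)) ` arcs G \<union> (\<lambda>e. (e, False)) ` arcs G"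
    by (simp only: UNIV_bool) blast
  show ?thesis
    by (simp only: arcs_ends_conv bidirect_simps split image_Un image_image) (auto simp: links_def)
qed

lemma cas_bidirect_links:
  "pre_digraph.cas (bidirect G) u p v \<Longrightarrow> (u, v) \<in> (links G (fst ` set p))\<^sup>*"
proof (induction p arbitrary: u)
  case Nil
  then show ?case by (simp add: pre_digraph.cas.simps)
next
  case (Cons x p)
  obtain e d where x: "x = (e, d)" by force
  have "(u, head (bidirect G) x) \<in> links G (fst ` set (x # p))"
    using Cons.prems by (cases d) (auto simp: pre_digraph.cas.simps x links_def)
  moreover have "(head (bidirect G) x, v) \<in> (links G (fst ` set (x # p)))\<^sup>*"
    using Cons by (auto simp: pre_digraph.cas.simps intro: links_rtrancl_mono)
  ultimately show ?case by (rule converse_rtrancl_into_rtrancl)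
qed

section \<open>Undirected cycles as reachability avoiding an arc\<close>

lemma undirected_cycle_subset:
  assumes "undirected_cycle G C"
  shows "C \<subseteq> arcs G"
proof -
  obtain u p where p: "pre_digraph.awalk (bidirect G) u p u" "C = fst ` set p"
    using assms by (auto simp: undirected_cycle_def pre_digraph.cycle_def)
  have "set p \<subseteq> arcs G \<times> UNIV"
    using p(1) by (simp add: pre_digraph.awalk_def)
  then have "fst ` set p \<subseteq> fst ` (arcs G \<times> (UNIV :: bool set))"
    by (rule image_mono)
  then show ?thesis
    using p(2) by simp
qed

text \<open>Cutting the cycle open at \<open>b\<close> leaves a walk between the ends of
  \<open>b\<close>.\<close>

lemma undirected_cycle_links:
  assumes "wf_digraph G" "undirected_cycle G C" "b \<in> C"
  shows "(tail G b, head G b) \<in> (links G (C - {b}))\<^sup>*"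
proof -
  interpret B: wf_digraph "bidirect G"
    using assms(1) by (rule wf_digraph_bidirect)
  obtain p u where p: "B.awalk u p u" "distinct (map fst p)" "C = fst ` set p"
    using assms(2) by (auto simp: undirected_cycle_def B.cycle_def)
  obtain d where "(b, d) \<in> set p" using p(3) assms(3) by force
  then obtain q r where qr: "p = q @ (b, d) # r" by (auto simp: in_set_conv_decomp)
  have "B.awalk u q (tail (bidirect G) (b, d))" "B.awalk (head (bidirect G) (b, d)) r u"
    using p(1) by (auto simp: qr B.awalk_Cons_iff)
  \<comment> \<open>The closed walk is rotated to start just after \<open>b\<close> and end just
    before it.\<close>
  then have "B.awalk (head (bidirect G) (b, d)) (r @ q) (tail (bidirect G) (b, d))"
    by (intro B.awalk_appendI)
  then have "B.cas (head (bidirect G) (b, d)) (r @ q) (tail (bidirect G) (b, d))"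
    by blast
  from cas_bidirect_links[OF this]
  have "(head (bidirect G) (b, d), tail (bidirect G) (b, d)) \<in> (links G (fst ` set (r @ q)))\<^sup>*" .
  \<comment> \<open>Distinctness of the underlying arcs excludes a second passage through
    \<open>b\<close> in either orientation.\<close>
  moreover have "fst ` set (r @ q) = C - {b}"
    using p(2,3) by (force simp: qr)
  ultimately show ?thesis
    by (cases d) (auto intro: links_rtrancl_sym)
qed

text \<open>Using an arc again, in whichever orientation, would revisit the vertex from which it was
  first entered, and a path repeats no vertex.\<close>

lemma apath_bidirect_distinct:
  assumes "wf_digraph G" "pre_digraph.apath (bidirect G) u p v"
  shows "distinct (map fst p)"
proof -
  interpret B: wf_digraph "bidirect G"
    using assms(1) by (rule wf_digraph_bidirect)
  show ?thesis using assms(2)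
  proof (induction p arbitrary: u)
    case (Cons x p)
    from Cons.prems have p: "B.apath (head (bidirect G) x) p v"
      and x: "tail (bidirect G) x \<notin> set (B.awalk_verts (head (bidirect G) x) p)"
      by (auto simp: B.apath_Cons_iff)
    have "fst x \<noteq> fst y" if "y \<in> set p" for y
    proof
      assume "fst x = fst y"
      then have "tail (bidirect G) x \<in> {tail (bidirect G) y, head (bidirect G) y}"
        by (metis bidirect_ends insertI1)
      moreover have "B.awalk (head (bidirect G) x) p v"
        using p by (simp add: B.apath_def)
      ultimately show False
        using x that by (auto simp: B.set_awalk_verts)
    qed
    with Cons.IH[OF p] show ?case by auto
  qed simp
qed

text \<open>A converse to \<open>undirected_cycle_links\<close>: a path joining the ends of
  \<open>b\<close> and avoiding \<open>b\<close> closes up with \<open>b\<close> to a cycle. For a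
  loop \<open>b\<close> the path is empty.\<close>

lemma ex_undirected_cycle:
  assumes "wf_digraph G" "b \<in> arcs G"
    and "(tail G b, head G b) \<in> (links G (arcs G - {b}))\<^sup>*"
  shows "\<exists>C. undirected_cycle G C"
proof -
  interpret wf_digraph G by fact
  let ?D = "del_arc b"
  have wfD: "wf_digraph ?D" ..
  interpret B: wf_digraph "bidirect G"
    using assms(1) by (rule wf_digraph_bidirect)
  interpret D: wf_digraph "bidirect ?D"
    using wfD by (rule wf_digraph_bidirect)
  have "links ?D = links G" by (rule links_cong) simp_all
  \<comment> \<open>The path has to run backwards, since the cycle traverses \<open>b\<close>
    forwards first.\<close>
  then have "(head G b, tail G b) \<in> (arcs_ends (bidirect ?D))\<^sup>*"
    using assms(3) by (simp add: arcs_ends_bidirect links_rtrancl_sym)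
  then have "head G b \<rightarrow>\<^sup>*\<^bsub>bidirect ?D\<^esub> tail G b"
    using assms(2) by (subst D.reachable_conv') simp_all
  then obtain p where p: "D.apath (head G b) p (tail G b)"
    by (auto simp: D.reachable_apath)
  have comp: "compatible (bidirect G) (bidirect ?D)"
    by (rule compatible_bidirect) simp_all
  have D: "D.awalk (head G b) p (tail G b)" "distinct (D.awalk_verts (head G b) p)"
    using p by (simp_all add: D.apath_def)
  have "B.awalk (tail G b) ((b, True) # p) (tail G b)"
    using D(1) assms(2) compatible_cas[OF comp]
    by (auto simp: B.awalk_Cons_iff B.awalk_def D.awalk_def)
  \<comment> \<open>Dropping the initial vertex leaves exactly the vertices of the path
    \<open>p\<close>.\<close>
  moreover have "distinct (tl (B.awalk_verts (tail G b) ((b, True) # p)))"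
    using D(2) compatible_awalk_verts[OF comp] by simp
  ultimately have "B.cycle ((b, True) # p)"
    unfolding B.cycle_def by blast
  moreover have "distinct (map fst ((b, True) # p))"
    using apath_bidirect_distinct[OF wfD p] D(1) by (auto simp: D.awalk_def)
  ultimately show ?thesis unfolding undirected_cycle_def by blast
qed

text \<open>Walks and their vertex lists depend only on the end maps, so the same arc list witnesses
  the cycle in any digraph with these maps that contains its arcs.\<close>

lemma undirected_cycle_transfer:
  assumes "undirected_cycle G C" "C \<subseteq> arcs H"
    and "wf_digraph G" "wf_digraph H" "tail G = tail H" "head G = head H"
  shows "undirected_cycle H C"
proof -
  interpret H: wf_digraph H by fact
  interpret BG: wf_digraph "bidirect G"
    using assms(3) by (rule wf_digraph_bidirect)
  interpret BH: wf_digraph "bidirect H"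
    using assms(4) by (rule wf_digraph_bidirect)
  have comp: "compatible (bidirect G) (bidirect H)"
    using assms(5,6) by (rule compatible_bidirect)
  obtain p u where p: "BG.awalk u p u" "distinct (tl (BG.awalk_verts u p))" "p \<noteq> []"
      "distinct (map fst p)" "C = fst ` set p"
    using assms(1) by (auto simp: undirected_cycle_def BG.cycle_def)
  have sub: "set p \<subseteq> arcs (bidirect H)"
    using p(5) assms(2) by (auto simp: mem_Times_iff)
  have cas: "BH.cas u p u"
    using p(1) compatible_cas[OF comp] by (auto simp: BG.awalk_def)
  \<comment> \<open>As \<open>p\<close> is nonempty, \<open>u\<close> is the tail of its first
    arc.\<close>
  have "u \<in> verts (bidirect H)"
    using cas sub p(3) BH.tail_in_verts by (cases p) auto
  then have "BH.awalk u p u" using cas sub by (simp add: BH.awalk_def)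
  then have "BH.cycle p"
    using p(2,3) compatible_awalk_verts[OF comp] unfolding BH.cycle_def by auto
  then show ?thesis using p(4,5) unfolding undirected_cycle_def by blast
qed

section \<open>Fundamental cycles and the exchange of arcs\<close>

text \<open>The end maps are total, so \<open>H\<close> assigns ends to \<open>a\<close> although
  \<open>a\<close> is not one of its arcs. As these ends are vertices of \<open>H\<close>,
  \<open>add_arc a\<close> keeps the vertex set.\<close>

locale tree_plus_arc = wf_digraph H for H :: "('v, 'a) pre_digraph" +
  fixes a :: 'a
  assumes tree: "undirected_tree H"
    and ends_in_verts: "tail H a \<in> verts H" "head H a \<in> verts H"
    and new_arc: "a \<notin> arcs H"
begin

lemma acyclic: "\<not> undirected_cycle H C"
  using tree by (auto simp: undirected_tree_def)

lemma linked:
  assumes "u \<in> verts H" "v \<in> verts H"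
  shows "(u, v) \<in> (links H (arcs H))\<^sup>*"
  using tree assms by (simp add: undirected_tree_def connected_iff_links wf_digraph)

lemma links_add_arc: "links (add_arc a) = links H"
  by (rule links_cong) simp_all

lemma new_arc_in_cycle:
  assumes "undirected_cycle (add_arc a) C"
  shows "a \<in> C"
proof (rule ccontr)
  assume "a \<notin> C"
  then have "C \<subseteq> arcs H" using undirected_cycle_subset[OF assms] by auto
  then have "undirected_cycle H C"
    using undirected_cycle_transfer[OF assms _ wf_digraph_add_arc wf_digraph] by simp
  then show False using acyclic by blast
qed

text \<open>If \<open>b\<close> lay on \<open>C\<close> but not on \<open>C'\<close>, the ends of
  \<open>b\<close> would be joined by the rest of \<open>C\<close>, with \<open>a\<close> replaced
  by the rest of \<open>C'\<close>. This connection stays in \<open>H\<close> and avoids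
  \<open>b\<close>, so \<open>H\<close> would contain a cycle.\<close>

lemma cycle_subset_cycle:
  assumes C: "undirected_cycle (add_arc a) C" and C': "undirected_cycle (add_arc a) C'"
  shows "C \<subseteq> C'"
proof (rule subsetI, rule ccontr)
  fix b assume b: "b \<in> C" "b \<notin> C'"
  have wf: "wf_digraph (add_arc a)" ..
  have ab: "a \<noteq> b" using b new_arc_in_cycle[OF C'] by auto
  have C'_sub: "C' - {a} \<subseteq> arcs H - {b}" and b_in: "b \<in> arcs H"
    using undirected_cycle_subset[OF C'] undirected_cycle_subset[OF C] b ab by auto
  have a_linked: "(tail H a, head H a) \<in> (links H (arcs H - {b}))\<^sup>*"
    using undirected_cycle_links[OF wf C' new_arc_in_cycle[OF C']] C'_sub
    by (auto simp: links_add_arc intro: links_rtrancl_mono)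
  have "(tail H b, head H b) \<in> (links H (C - {b}))\<^sup>*"
    using undirected_cycle_links[OF wf C b(1)] by (simp add: links_add_arc)
  then have "(tail H b, head H b) \<in> (links H (arcs H - {b}))\<^sup>*"
  proof (rule links_rtrancl_replace)
    fix e assume "e \<in> C - {b}"
    then have "e = a \<or> e \<in> arcs H - {b}"
      using undirected_cycle_subset[OF C] by auto
    then show "(tail H e, head H e) \<in> (links H (arcs H - {b}))\<^sup>*"
      using a_linked linksI[of e "arcs H - {b}" H] by blast
  qed
  then show False
    using ex_undirected_cycle[OF wf_digraph b_in] acyclic by blast
qed

text \<open>Existence comes from connectedness of \<open>H\<close>, uniqueness from
  \<open>cycle_subset_cycle\<close> applied in both directions. This justifies the definite
  description in \<open>fundamental_cycle\<close>.\<close>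

lemma ex1_cycle: "\<exists>!C. undirected_cycle (add_arc a) C"
proof -
  have "(tail H a, head H a) \<in> (links H (arcs (add_arc a) - {a}))\<^sup>*"
    using linked[OF ends_in_verts] new_arc by simp
  then have "\<exists>C. undirected_cycle (add_arc a) C"
    using ex_undirected_cycle[of "add_arc a" a] by (simp add: links_add_arc wf_digraph_add_arc)
  then show ?thesis using cycle_subset_cycle by blast
qed

lemma undirected_cycle_fundamental_cycle:
  "undirected_cycle (add_arc a) (fundamental_cycle H a)"
  unfolding fundamental_cycle_def using ex1_cycle by (rule theI')

text \<open>Connectedness survives because the rest of the fundamental cycle bypasses
  \<open>b\<close>. Acyclicity holds because the only cycle of \<open>H\<close> plus
  \<open>a\<close> passes through \<open>b\<close>.\<close>

lemma exchange_tree: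
  assumes b: "b \<in> fundamental_cycle H a"
  shows "undirected_tree (pre_digraph.del_arc (add_arc a) b)"
proof -
  interpret A: wf_digraph "add_arc a" ..
  let ?H' = "A.del_arc b"
  have wf': "wf_digraph ?H'" ..
  have links': "links ?H' = links H" by (rule links_cong) simp_all
  let ?C = "fundamental_cycle H a"
  note C = undirected_cycle_fundamental_cycle
  have b_linked: "(tail H b, head H b) \<in> (links H (arcs ?H'))\<^sup>*"
    using undirected_cycle_links[OF A.wf_digraph C b] undirected_cycle_subset[OF C]
    by (auto simp: links_add_arc intro: links_rtrancl_mono)
  have "(u, v) \<in> (links H (arcs ?H'))\<^sup>*" if "u \<in> verts H" "v \<in> verts H" for u v
    using linked[OF that]
  proof (rule links_rtrancl_replace)
    fix e assume "e \<in> arcs H"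
    then have "e = b \<or> e \<in> arcs ?H'" by auto
    then show "(tail H e, head H e) \<in> (links H (arcs ?H'))\<^sup>*"
      using b_linked linksI[of e "arcs ?H'" H] by blast
  qed
  moreover have "verts H \<noteq> {}" using ends_in_verts by auto
  ultimately have "Digraph_Component.connected ?H'"
    using ends_in_verts by (simp add: connected_iff_links[OF wf'] links')
  moreover have "\<not> undirected_cycle ?H' D" for D
  proof
    assume D: "undirected_cycle ?H' D"
    note sub = undirected_cycle_subset[OF D]
    have "undirected_cycle (add_arc a) D"
      using D by (rule undirected_cycle_transfer) (use sub in \<open>auto intro: wf' A.wf_digraph\<close>)
    then have "D = ?C" using C ex1_cycle by blast
    then show False using b sub by auto
  qed
  ultimately show ?thesis by (simp add: undirected_tree_def)
qed

end

section \<open>Weight comparison and divisibility\<close>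

text \<open>Exchanging \<open>b\<close> for \<open>a\<close> yields another spanning tree; its
  weight gains \<open>c a\<close> and loses \<open>c b\<close>, so maximality of \<open>H\<close>
  bounds \<open>c a\<close>.\<close>

lemma max_weight_spanning_tree_le:
  assumes "fin_digraph G" "max_weight_spanning_tree G c H"
    and a: "a \<in> arcs G" "a \<notin> arcs H" and b: "b \<in> fundamental_cycle H a"
  shows "c a \<le> c b"
proof (cases "b = a")
  case False
  interpret G: fin_digraph G by fact
  have sub: "subgraph H G" and verts: "verts G = verts H" and tree: "undirected_tree H"
    using assms(2)
    by (auto simp: max_weight_spanning_tree_def undirected_spanning_tree_def spanning_def)
  have comp: "tail G = tail H" "head G = head H"
    using sub by (auto simp: subgraph_def compatible_def)
  have ends: "tail H a \<in> verts H" "head H a \<in> verts H"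
    using a(1) G.wellformed[of a] by (simp_all add: comp verts)
  have wfH: "wf_digraph H" using sub by auto
  interpret tree_plus_arc H a
    using wfH tree ends a(2) by (simp add: tree_plus_arc_def tree_plus_arc_axioms_def)
  interpret A: wf_digraph "add_arc a" ..
  let ?H' = "A.del_arc b"
  have "b \<in> arcs (add_arc a)"
    using undirected_cycle_subset[OF undirected_cycle_fundamental_cycle] b by blast
  then have bH: "b \<in> arcs H" using False by simp
  have arcs_sub: "arcs H \<subseteq> arcs G" using sub by auto
  then have fin: "finite (arcs H)" by (rule finite_subset) simp
  have "subgraph ?H' G"
    by (rule subgraphI)
      (use ends arcs_sub a(1) in \<open>auto simp: verts comp compatible_def G.wf_digraph
        intro: A.wf_digraph_del_arc\<close>)
  then have "undirected_spanning_tree ?H' G"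
    using exchange_tree[OF b] ends
    by (simp add: undirected_spanning_tree_def spanning_def verts)
  then have "sum c (arcs ?H') \<le> sum c (arcs H)"
    using assms(2) unfolding max_weight_spanning_tree_def by blast
  moreover have "arcs ?H' = insert a (arcs H - {b})"
    using False by auto
  moreover have "sum c (arcs H) = c b + sum c (arcs H - {b})"
    using fin bH by (rule sum.remove)
  ultimately show ?thesis using fin a(2) by simp
qed simp

text \<open>When one of two periods divides the other, their gcd is the dividing one. Hence
  harmonicity can be applied to arc periods as well.\<close>

lemma harmonic_arc_period:
  assumes "wf_digraph G" "harmonic G T" "a \<in> arcs G"
  shows "arc_period G T a \<in> T ` verts G"
proof -
  interpret wf_digraph G by fact
  have "T (tail G a) dvd T (head G a) \<or> T (head G a) dvd T (tail G a)"
    using assms(2,3) by (simp add: harmonic_def)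
  then show ?thesis
    using assms(3) by (auto simp: arc_period_def gcd_nat.absorb1 gcd_nat.absorb2)
qed

theorem theorem7:
  fixes G H :: "('v, 'a) pre_digraph"
    and T :: "'v \<Rightarrow> nat"
    and l u w :: "'a \<Rightarrow> real"
  assumes "mpesp_instance G T l u w"
    and "harmonic G T"
    and "Digraph_Component.connected G"
    and "max_weight_spanning_tree G (arc_period G T) H"
  shows "undirected_spanning_tree H G \<and> sharp G T H"
proof
  show st: "undirected_spanning_tree H G"
    using assms(4) by (simp add: max_weight_spanning_tree_def)
  interpret G: fin_digraph G
    using assms(1) by (simp add: mpesp_instance_def)
  have sub: "subgraph H G" "verts G = verts H" "undirected_tree H"
    using st by (auto simp: undirected_spanning_tree_def spanning_def)
  show "sharp G T H"
    unfolding sharp_def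
  proof
    fix a assume a: "a \<in> arcs G - arcs H"
    have "tail H a \<in> verts H" "head H a \<in> verts H"
      using a sub G.wellformed[of a] by (auto simp: subgraph_def compatible_def)
    then interpret tree_plus_arc H a
      using a sub by (auto simp: tree_plus_arc_def tree_plus_arc_axioms_def)
    let ?C = "fundamental_cycle H a"
    note C = undirected_cycle_fundamental_cycle
    have C_sub: "?C \<subseteq> arcs G"
      using undirected_cycle_subset[OF C] a sub(1) by auto
    have "arc_period G T a dvd arc_period G T b" if b: "b \<in> ?C" for b
    proof -
      have "arc_period G T a \<in> T ` verts G" "arc_period G T b \<in> T ` verts G"
        using a b C_sub by (auto intro: harmonic_arc_period assms(2) G.wf_digraph)
      then have "arc_period G T a dvd arc_period G T b \<or> arc_period G T b dvd arc_period G T a"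
        and "0 < arc_period G T a"
        using assms(1,2) unfolding harmonic_def mpesp_instance_def by (blast, auto)
      moreover have "arc_period G T a \<le> arc_period G T b"
        using max_weight_spanning_tree_le[OF G.fin_digraph assms(4)] a b by blast
      \<comment> \<open>If the divisibility goes the other way, positivity turns it into the reverse
        inequality, and the two periods coincide.\<close>
      ultimately show ?thesis by (metis dvd_imp_le dvd_refl le_antisym)
    qed
    then have "arc_period G T a dvd cycle_period G T ?C"
      unfolding cycle_period_def by (auto intro: Gcd_greatest)
    \<comment> \<open>The co-tree arc \<open>a\<close> itself lies on its fundamental cycle.\<close>
    moreover have "cycle_period G T ?C dvd arc_period G T a"
      unfolding cycle_period_def using new_arc_in_cycle[OF C] by (auto intro: Gcd_dvd)
    ultimately show "cycle_period G T ?C = arc_period G T a" by (rule dvd_antisym[rotated])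
  qed
qed

end
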